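(* Let $\mathbb F$ be $\mathbb R$ or $\mathbb C$, and let $\mathcal C^M$ be any Denjoy-Carleman class. Then there exists $f \in \mathcal C^\infty(\mathbb R,\mathbb F)$ satisfying: (1) $f \in \mathcal C^M(\mathbb R\setminus\{0\},\mathbb F)$ (i.e. the restriction of $f$ to $\mathbb R\setminus\{0\}$ is in this set); (2) $f \in \mathcal F^M(0,\mathbb F)$; (3) $f \notin \mathcal C^M(\mathbb R,\mathbb F)$.
   Context: $\mathbb N$ is the set of non-negative integers. A weight sequence is a non-decreasing sequence $M=(M_n)_{n\ge 0}$ of positive real numbers with $M_0=1$ that is logarithmically convex, i.e. the ratios $M_{n+1}/M_n$ form a non-decreasing sequence; every Denjoy-Carleman class is taken with respect to such a sequence. $\mathcal C^\infty(U,\mathbb F)$ is the algebra of smooth $\mathbb F$-valued functions on an open set $U$. For $U\subseteq\mathbb R^p$ open, $\mathcal C^M(U,\mathbb F)$ is the set of $f\in\mathcal C^\infty(U,\mathbb F)$ such that for every $x\in U$ there are an open $V\subseteq U$ containing $x$ and constants $A,B>0$ with $|D^\alpha f(y)|\le A B^{|\alpha|}|\alpha|!\,M_{|\alpha|}$ for all $\alpha\in\mathbb N^p$ and all $y\in V$. The class $\mathcal C^M$ determined in this way is called a Denjoy-Carleman class. A function $f\in\mathcal C^\infty(U,\mathbb F)$ is formally $\mathcal C^M$ at a point $y\in U$, written $f\in\mathcal F^M(y,\mathbb F)$, if there are constants $A,B>0$ such that $|D^\alpha f(y)|\le A B^{|\alpha|}|\alpha|!\,M_{|\alpha|}$ for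 all $\alpha\in\mathbb N^p$ (bounds at the single point $y$ only). *)

theory Defs
  imports "HOL-Analysis.Analysis"
begin

definition weight_sequence :: "(nat \<Rightarrow> real) \<Rightarrow> bool" where
  "weight_sequence M \<longleftrightarrow>
     M 0 = 1 \<and> (\<forall>n. M n > 0) \<and> mono M \<and> mono (\<lambda>n. M (Suc n) / M n)"

text \<open>
  All functions below have an open subset of the real line as their domain (the case \<open>p = 1\<close> of
  the classes on open subsets of \<open>p\<close>-dimensional space), so that a multi-index is a natural number
  and its factorial is \<open>fact n\<close>. A function on an open set \<open>U\<close> is represented by a total
  function whose values outside \<open>U\<close> are irrelevant: derivatives are taken at points of \<open>U\<close>,
  which is open, so they depend only on the restriction to \<open>U\<close>.
\<close>

definition nth_derivative :: "nat \<Rightarrow> (real \<Rightarrow> 'b) \<Rightarrow> real \<Rightarrow> 'b::real_normed_vector" where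
  "nth_derivative n f = ((\<lambda>g x. vector_derivative g (at x)) ^^ n) f"

text \<open>
  Outside points of differentiability \<open>vector_derivative\<close> is an unspecified value; the definition
  requires the existence of each derivative in turn, so no such value enters on \<open>U\<close>.
\<close>

definition smooth_functions :: "real set \<Rightarrow> (real \<Rightarrow> 'b::real_normed_vector) set" where
  "smooth_functions U = {f. \<forall>n. \<forall>x\<in>U. nth_derivative n f differentiable (at x)}"

definition denjoy_carleman ::
    "(nat \<Rightarrow> real) \<Rightarrow> real set \<Rightarrow> (real \<Rightarrow> 'b::real_normed_vector) set" where
  "denjoy_carleman M U = {f \<in> smooth_functions U.
     \<forall>x\<in>U. \<exists>V. open V \<and> V \<subseteq> U \<and> x \<in> V \<and>
       (\<exists>A>0. \<exists>B>0. \<forall>n. \<forall>y\<in>V. norm (nth_derivative n f y) \<le> A * B ^ n * fact n * M n)}"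

text \<open>
  The open set \<open>U\<close> on which \<open>f\<close> is smooth is implicit in the usual notation for the functions
  that are formally of the class at \<open>y\<close>; here it is an explicit argument.
\<close>

definition formally_denjoy_carleman ::
    "(nat \<Rightarrow> real) \<Rightarrow> real set \<Rightarrow> real \<Rightarrow> (real \<Rightarrow> 'b::real_normed_vector) set" where
  "formally_denjoy_carleman M U y = {f \<in> smooth_functions U. y \<in> U \<and>
     (\<exists>A>0. \<exists>B>0. \<forall>n. norm (nth_derivative n f y) \<le> A * B ^ n * fact n * M n)}"

end

theory Submission
  imports Defs "HOL-Complex_Analysis.Cauchy_Integral_Formula"
begin

text \<open>
  The function is \<open>f(x) = exp(-1/x^2) g(x)\<close> with
  \<open>g(x) = \<Sum>k. (1/lam k)^k / (x - p k)\<close> and poles \<open>p k = 1/(k+1) + i/lam k\<close> off the real line. The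
  poles accumulate only at \<open>0\<close>, so \<open>f\<close> is real analytic off \<open>0\<close>, hence in the class since
  \<open>M \<ge> 1\<close>. The coefficients make \<open>g\<close> smooth on the whole line, so \<open>f\<close> is smooth and flat at \<open>0\<close>.
  The \<open>k\<close>-th derivative of the \<open>k\<close>-th term at \<open>1/(k+1)\<close> has modulus \<open>k! lam k\<close>, so a recursive
  choice of \<open>lam\<close> makes the \<open>k\<close>-th derivative of \<open>g\<close> there exceed any prescribed bound. If \<open>f\<close> were
  in the class near \<open>0\<close>, Leibniz' rule for \<open>g = f exp(1/x^2)\<close> would bound these derivatives by
  numbers depending only on \<open>k\<close>, \<open>M\<close> and the derivatives of \<open>exp(1/x^2)\<close> at \<open>1/(k+1)\<close>; the choice
  of \<open>lam\<close> rules this out. In the real case, the real or the imaginary part of \<open>f\<close> works, for if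
  both were in the class then so would be \<open>f\<close>.
\<close>

section \<open>Sequences of successive derivatives\<close>

text \<open>All derivatives are carried along as one explicit family, so that formulas and bounds
  for them can be stated without iterating \<open>vector_derivative\<close>.\<close>

definition derivative_sequence ::
    "real set \<Rightarrow> (nat \<Rightarrow> real \<Rightarrow> 'b::real_normed_vector) \<Rightarrow> bool" where
  "derivative_sequence U F \<longleftrightarrow>
     (\<forall>n. \<forall>x\<in>U. (F n has_vector_derivative F (Suc n) x) (at x))"

text \<open>Derivatives at points of an open set see \<open>f\<close> only on that set. Hence two
  families starting from the same function on \<open>U\<close> agree on \<open>U\<close>, which
  later identifies the derivatives of a product computed in two ways.\<close>

lemma nth_derivative_eq:
  assumes "open U" "derivative_sequence U F" "\<And>x. x \<in> U \<Longrightarrow> f x = F 0 x" "x \<in> U"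
  shows "nth_derivative n f x = F n x"
  using assms(4)
proof (induction n arbitrary: x)
  case 0
  then show ?case using assms(3) by (simp add: nth_derivative_def)
next
  case (Suc n)
  have "(F n has_vector_derivative F (Suc n) x) (at x)"
    using assms(2) Suc.prems by (simp add: derivative_sequence_def)
  then have "(nth_derivative n f has_vector_derivative F (Suc n) x) (at x)"
    by (rule has_vector_derivative_transform_within_open[OF _ assms(1) Suc.prems])
      (simp add: Suc.IH)
  then show ?case
    by (simp add: nth_derivative_def vector_derivative_at)
qed

lemma smooth_functions_derivative_sequence:
  assumes "open U" "derivative_sequence U F" "\<And>x. x \<in> U \<Longrightarrow> f x = F 0 x"
  shows "f \<in> smooth_functions U"
proof -
  have "nth_derivative n f differentiable at x" if "x \<in> U" for n x
  proof -
    have "(F n has_vector_derivative F (Suc n) x) (at x)"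
      using assms(2) that by (simp add: derivative_sequence_def)
    then have "(nth_derivative n f has_vector_derivative F (Suc n) x) (at x)"
      by (rule has_vector_derivative_transform_within_open[OF _ assms(1) that])
        (simp add: nth_derivative_eq[OF assms])
    then show ?thesis by (rule differentiableI_vector)
  qed
  then show ?thesis by (simp add: smooth_functions_def)
qed

lemma derivative_sequence_bounded_linear:
  assumes "bounded_linear T" "derivative_sequence U F"
  shows "derivative_sequence U (\<lambda>n x. T (F n x))"
  using assms bounded_linear.has_vector_derivative[OF assms(1)]
  by (auto simp: derivative_sequence_def)

lemma derivative_sequence_mult:
  fixes F G :: "nat \<Rightarrow> real \<Rightarrow> 'b::real_normed_field"
  assumes "derivative_sequence U F" "derivative_sequence U G"
  shows "derivative_sequence U (\<lambda>n x. \<Sum>j\<le>n. of_nat (n choose j) * (F j x * G (n - j) x))"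
  unfolding derivative_sequence_def
proof (intro allI ballI)
  fix n x assume x: "x \<in> U"
  have F: "(F j has_vector_derivative F (Suc j) x) (at x)"
    and G: "(G j has_vector_derivative G (Suc j) x) (at x)" for j
    using assms x by (auto simp: derivative_sequence_def)
  let ?a = "\<lambda>j. F j x * G (Suc n - j) x"
  have "((\<lambda>x. \<Sum>j\<le>n. of_nat (n choose j) * (F j x * G (n - j) x)) has_vector_derivative
      (\<Sum>j\<le>n. of_nat (n choose j) * (F j x * G (Suc (n - j)) x + F (Suc j) x * G (n - j) x))) (at x)"
    by (intro has_vector_derivative_sum has_vector_derivative_mult_right has_vector_derivative_mult F G)
  also have "(\<Sum>j\<le>n. of_nat (n choose j) * (F j x * G (Suc (n - j)) x + F (Suc j) x * G (n - j) x))
      = (\<Sum>j\<le>n. of_nat (n choose j) * ?a j) + (\<Sum>j\<le>n. of_nat (n choose j) * ?a (Suc j))"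
    by (simp add: sum.distrib distrib_left Suc_diff_le)
  \<comment> \<open>The summand for \<open>j = Suc n\<close> may be added because
    \<open>n choose Suc n = 0\<close>; splitting off \<open>j = 0\<close> then aligns both sums for
    Pascal's rule.\<close>
  also have "(\<Sum>j\<le>n. of_nat (n choose j) * ?a j) =
      ?a 0 + (\<Sum>j\<le>n. of_nat (n choose Suc j) * ?a (Suc j))"
  proof -
    have "(\<Sum>j\<le>n. of_nat (n choose j) * ?a j) = (\<Sum>j\<le>Suc n. of_nat (n choose j) * ?a j)"
      by simp
    also have "\<dots> = ?a 0 + (\<Sum>j\<le>n. of_nat (n choose Suc j) * ?a (Suc j))"
      by (subst sum.atMost_Suc_shift) simp
    finally show ?thesis .
  qed
  also have "?a 0 + (\<Sum>j\<le>n. of_nat (n choose Suc j) * ?a (Suc j)) +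
      (\<Sum>j\<le>n. of_nat (n choose j) * ?a (Suc j)) = (\<Sum>j\<le>Suc n. of_nat (Suc n choose j) * ?a j)"
    by (subst sum.atMost_Suc_shift) (simp add: sum.distrib[symmetric] algebra_simps)
  finally show "((\<lambda>x. \<Sum>j\<le>n. of_nat (n choose j) * (F j x * G (n - j) x)) has_vector_derivative
      (\<Sum>j\<le>Suc n. of_nat (Suc n choose j) * (F j x * G (Suc n - j) x))) (at x)" .
qed

text \<open>The factorials \<open>fact j\<close> and \<open>fact (n - j)\<close> cancel the binomial
  coefficient up to \<open>fact n\<close>. So bounds of analytic type survive multiplication, with
  the rates added.\<close>

lemma norm_leibniz_le:
  fixes u v :: "nat \<Rightarrow> 'b::real_normed_field"
  assumes "\<And>j. norm (u j) \<le> A * B ^ j * fact j" "\<And>j. norm (v j) \<le> C * D ^ j * fact j"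
    and "A \<ge> 0" "B \<ge> 0" "C \<ge> 0" "D \<ge> 0"
  shows "norm (\<Sum>j\<le>n. of_nat (n choose j) * (u j * v (n - j))) \<le> A * C * (B + D) ^ n * fact n"
proof -
  have "norm (of_nat (n choose j) * (u j * v (n - j)))
      \<le> (A * C * fact n) * (of_nat (n choose j) * B ^ j * D ^ (n - j))" if "j \<le> n" for j
  proof -
    have "norm (of_nat (n choose j) * (u j * v (n - j)))
        \<le> real (n choose j) * ((A * B ^ j * fact j) * (C * D ^ (n - j) * fact (n - j)))"
      unfolding norm_mult norm_of_nat using assms by (intro mult_left_mono mult_mono) auto
    also have "\<dots> = (A * C * (B ^ j * D ^ (n - j))) * real (fact j * fact (n - j) * (n choose j))"
      by (simp add: algebra_simps)
    also have "\<dots> = (A * C * (B ^ j * D ^ (n - j))) * fact n"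
      by (simp only: binomial_fact_lemma[OF that]) simp
    \<comment> \<open>A coefficient that is at least 1 is put back, so that the binomial theorem
      sums the bounds.\<close>
    also have "\<dots> \<le> (A * C * (B ^ j * D ^ (n - j))) * fact n * real (n choose j)"
    proof -
      have "1 \<le> real (n choose j)" using that by (simp add: Suc_leI zero_less_binomial)
      then show ?thesis using assms
        by (metis (no_types, lifting) fact_ge_zero mult.right_neutral mult_left_mono mult_nonneg_nonneg zero_le_power)
    qed
    finally show ?thesis by (simp add: algebra_simps)
  qed
  then have "norm (\<Sum>j\<le>n. of_nat (n choose j) * (u j * v (n - j))) \<le>
      (\<Sum>j\<le>n. (A * C * fact n) * (of_nat (n choose j) * B ^ j * D ^ (n - j)))"
    by (intro sum_norm_le) simp
  also have "\<dots> = A * C * (B + D) ^ n * fact n"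
    by (simp add: sum_distrib_left[symmetric] binomial_ring)
  finally show ?thesis .
qed

lemma derivative_sequence_holomorphic:
  assumes "open S" "f holomorphic_on S" "\<And>x. x \<in> U \<Longrightarrow> complex_of_real x \<in> S"
  shows "derivative_sequence U (\<lambda>n x. (deriv ^^ n) f (complex_of_real x))"
  unfolding derivative_sequence_def
proof (intro allI ballI)
  fix n x assume "x \<in> U"
  then have "((deriv ^^ n) f has_field_derivative (deriv ^^ Suc n) f (complex_of_real x))
      (at (complex_of_real x))"
    using assms holomorphic_higher_deriv[OF assms(2,1)] by (auto intro: holomorphic_derivI)
  then show "((\<lambda>x. (deriv ^^ n) f (complex_of_real x)) has_vector_derivative
      (deriv ^^ Suc n) f (complex_of_real x)) (at x)"
    by (rule has_vector_derivative_real_field)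
qed

section \<open>The flat factor\<close>

text \<open>With \<open>z = u + iv\<close>, the real part of \<open>1 / z^2\<close> is
  \<open>(u^2 - v^2) / (u^2 + v^2)^2\<close>. In the disc of radius \<open>\<bar>x\<bar> / 4\<close>
  the numerator is at least \<open>x^2 / 2\<close> and the denominator at most
  \<open>3 * x^4\<close>.\<close>

lemma norm_exp_minus_inverse_square_le:
  fixes z :: complex and x :: real
  assumes "x \<noteq> 0" "norm (z - of_real x) \<le> \<bar>x\<bar> / 4"
  shows "norm (exp (- 1 / z\<^sup>2)) \<le> exp (- 1 / (6 * x\<^sup>2))"
proof -
  define u v where "u = Re z" and "v = Im z"
  have "\<bar>u - x\<bar> \<le> \<bar>x\<bar> / 4" and v: "\<bar>v\<bar> \<le> \<bar>x\<bar> / 4"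
    using assms(2) abs_Re_le_cmod[of "z - of_real x"] abs_Im_le_cmod[of "z - of_real x"]
    by (auto simp: u_def v_def)
  then have u: "3 / 4 * \<bar>x\<bar> \<le> \<bar>u\<bar>" "\<bar>u\<bar> \<le> 5 / 4 * \<bar>x\<bar>" by linarith+
  define X where "X = x\<^sup>2"
  have X: "X > 0" using assms(1) by (simp add: X_def)
  have u1: "9 / 16 * X \<le> u\<^sup>2" and u2: "u\<^sup>2 \<le> 25 / 16 * X" and v1: "v\<^sup>2 \<le> 1 / 16 * X"
    using power_mono[OF u(1), of 2] power_mono[OF u(2), of 2] power_mono[OF v, of 2]
    by (simp_all add: X_def power_mult_distrib power_divide)
  have s: "0 < u\<^sup>2 + v\<^sup>2" "u\<^sup>2 + v\<^sup>2 \<le> 13 / 8 * X" using u1 u2 v1 X zero_le_power2[of v] by linarith+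
  have "(u\<^sup>2 + v\<^sup>2)\<^sup>2 \<le> (13 / 8 * X)\<^sup>2" using s by (intro power_mono) auto
  also have "\<dots> \<le> 3 * X * X" using X by (simp add: power2_eq_square)
  also have "\<dots> \<le> 6 * X * (u\<^sup>2 - v\<^sup>2)"
    using u1 v1 X mult_left_mono[of "X / 2" "u\<^sup>2 - v\<^sup>2" "6 * X"] by simp
  finally have *: "1 / (6 * X) \<le> (u\<^sup>2 - v\<^sup>2) / (u\<^sup>2 + v\<^sup>2)\<^sup>2"
    using X zero_less_power[OF s(1), of 2]
    by (simp add: pos_le_divide_eq pos_divide_le_eq mult.commute)
  have "Re (1 / z\<^sup>2) = (u\<^sup>2 - v\<^sup>2) / (u\<^sup>2 + v\<^sup>2)\<^sup>2"
  proof -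
    have "(u\<^sup>2 - v\<^sup>2)\<^sup>2 + (2 * u * v)\<^sup>2 = (u\<^sup>2 + v\<^sup>2)\<^sup>2"
      by (simp add: power2_eq_square algebra_simps)
    then show ?thesis by (simp add: Re_divide u_def v_def power2_eq_square[of z]) (simp add: power2_eq_square algebra_simps)
  qed
  then show ?thesis using * by (simp add: X_def)
qed

text \<open>The point 0 is separate because division by zero would give the exponential the value 1
  there, while the flat extension vanishes to all orders.\<close>

definition flat :: "nat \<Rightarrow> real \<Rightarrow> complex" where
  "flat n x = (if x = 0 then 0 else (deriv ^^ n) (\<lambda>z. exp (- 1 / z\<^sup>2)) (of_real x))"

lemma flat_0: "x \<noteq> 0 \<Longrightarrow> flat 0 x = exp (- 1 / (of_real x)\<^sup>2)"
  by (simp add: flat_def)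

text \<open>Cauchy's inequality on the circle of radius \<open>\<bar>x\<bar> / 4\<close>, which
  avoids the singularity at 0.\<close>

lemma norm_flat_le:
  assumes "x \<noteq> 0"
  shows "norm (flat n x) \<le> exp (- 1 / (6 * x\<^sup>2)) * (4 / \<bar>x\<bar>) ^ n * fact n"
proof -
  have nz: "z \<noteq> 0" if "norm (z - of_real x) \<le> \<bar>x\<bar> / 4" for z :: complex
    using that assms by (auto simp: norm_minus_commute)
  have "(\<lambda>z. exp (- 1 / z\<^sup>2)) holomorphic_on (- {0 :: complex})"
    by (intro holomorphic_intros) auto
  then have h: "(\<lambda>z. exp (- 1 / z\<^sup>2)) holomorphic_on cball (of_real x) (\<bar>x\<bar> / 4)"
    by (rule holomorphic_on_subset) (use nz in \<open>auto simp: dist_norm norm_minus_commute\<close>)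
  have "norm ((deriv ^^ n) (\<lambda>z. exp (- 1 / z\<^sup>2)) (complex_of_real x))
      \<le> fact n * exp (- 1 / (6 * x\<^sup>2)) / (\<bar>x\<bar> / 4) ^ n"
  proof (rule Cauchy_inequality)
    show "(\<lambda>z. exp (- 1 / z\<^sup>2)) holomorphic_on ball (of_real x) (\<bar>x\<bar> / 4)"
      using h holomorphic_on_subset ball_subset_cball by blast
    show "continuous_on (cball (complex_of_real x) (\<bar>x\<bar> / 4)) (\<lambda>z. exp (- 1 / z\<^sup>2))"
      using h by (rule holomorphic_on_imp_continuous_on)
    show "norm (exp (- 1 / z\<^sup>2)) \<le> exp (- 1 / (6 * x\<^sup>2))"
      if "norm (complex_of_real x - z) = \<bar>x\<bar> / 4" for z
      using that by (intro norm_exp_minus_inverse_square_le assms) (simp add: norm_minus_commute)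
  qed (use assms in auto)
  then show ?thesis using assms by (simp add: flat_def field_simps)
qed

text \<open>The exponential beats every negative power of \<open>x\<close>; a spare factor
  \<open>x^2\<close> is kept to obtain differentiability at 0.\<close>

lemma flat_quadratic_bound:
  assumes "\<bar>x\<bar> \<le> 1"
  shows "norm (flat n x) \<le> 4 ^ n * (6 * real (Suc n)) ^ Suc n * fact n * x\<^sup>2"
proof (cases "x = 0")
  case False
  define t where "t = 1 / (6 * x\<^sup>2)"
  have t: "t > 0" using False by (simp add: t_def)
  \<comment> \<open>From \<open>s \<le> exp s\<close> at \<open>s = t / (n + 1)\<close>, raised to
    the power \<open>n + 1\<close>, follows a bound of \<open>exp (- t)\<close> by a multiple of
    \<open>x^(2n + 2)\<close>.\<close>
  have "(t / real (Suc n)) ^ Suc n \<le> exp (t / real (Suc n)) ^ Suc n"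
  proof (rule power_mono)
    show "t / real (Suc n) \<le> exp (t / real (Suc n))"
      using exp_ge_add_one_self[of "t / real (Suc n)"] by linarith
  qed (use t in auto)
  also have "\<dots> = exp t"
    by (metis exp_divide_power_eq zero_less_Suc)
  finally have "exp (- t) \<le> inverse ((t / real (Suc n)) ^ Suc n)"
    unfolding exp_minus using t by (intro le_imp_inverse_le zero_less_power) auto
  also have "\<dots> = inverse (t / real (Suc n)) ^ Suc n" by (rule power_inverse[symmetric])
  also have "inverse (t / real (Suc n)) = 6 * real (Suc n) * x\<^sup>2" by (simp add: t_def)
  finally have e: "exp (- t) \<le> (6 * real (Suc n) * x\<^sup>2) ^ Suc n" .
  have "norm (flat n x) \<le> exp (- t) * (4 / \<bar>x\<bar>) ^ n * fact n"
    using norm_flat_le[OF False, of n] by (simp add: t_def)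
  also have "\<dots> \<le> (6 * real (Suc n) * x\<^sup>2) ^ Suc n * (4 / \<bar>x\<bar>) ^ n * fact n"
    by (intro mult_right_mono e) auto
  \<comment> \<open>Of the \<open>n + 1\<close> factors \<open>x^2\<close>, \<open>n\<close> absorb
    the negative powers of \<open>\<bar>x\<bar>\<close> and one remains.\<close>
  also have "\<dots> = (6 * real (Suc n)) ^ Suc n * x\<^sup>2 * (x\<^sup>2 * (4 / \<bar>x\<bar>)) ^ n * fact n"
    by (simp only: power_mult_distrib power_Suc mult_ac)
  also have "x\<^sup>2 * (4 / \<bar>x\<bar>) = 4 * \<bar>x\<bar>"
    by (simp add: power2_eq_square abs_if)
  also have "(6 * real (Suc n)) ^ Suc n * x\<^sup>2 * (4 * \<bar>x\<bar>) ^ n * fact n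
      \<le> (6 * real (Suc n)) ^ Suc n * x\<^sup>2 * 4 ^ n * fact n"
    using assms by (intro mult_right_mono mult_left_mono power_mono) auto
  finally show ?thesis by (simp only: mult_ac)
qed (simp add: flat_def)

lemma derivative_sequence_flat: "derivative_sequence UNIV flat"
proof -
  have *: "derivative_sequence (- {0}) (\<lambda>n x. (deriv ^^ n) (\<lambda>z. exp (- 1 / z\<^sup>2)) (complex_of_real x))"
    by (rule derivative_sequence_holomorphic[of "- {0}"]) (auto intro!: holomorphic_intros)
  have "(flat n has_vector_derivative flat (Suc n) x) (at x)" for n x
  proof (cases "x = 0")
    case False
    then have "((\<lambda>x. (deriv ^^ n) (\<lambda>z. exp (- 1 / z\<^sup>2)) (complex_of_real x)) has_vector_derivative
        flat (Suc n) x) (at x)"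
      using * by (auto simp: derivative_sequence_def flat_def)
    then show ?thesis
      by (rule has_vector_derivative_transform_within_open[of _ _ _ "- {0}"])
        (use False in \<open>auto simp: flat_def\<close>)
  next
    case True
    define C :: real where "C = 4 ^ n * (6 * real (Suc n)) ^ Suc n * fact n"
    have C: "norm (flat n y) \<le> C * y\<^sup>2" if "\<bar>y\<bar> \<le> 1" for y
      unfolding C_def using that by (rule flat_quadratic_bound)
    have "((\<lambda>y. norm (flat n y) / norm y) \<longlongrightarrow> 0) (at 0)"
    proof (rule Lim_null_comparison)
      show "\<forall>\<^sub>F y in at 0. norm (norm (flat n y) / norm y) \<le> C * \<bar>y\<bar>"
      proof (rule eventually_mono[OF eventually_at_ball'[of 1 0 UNIV]])
        fix y :: real assume "y \<in> ball 0 1 \<and> y \<noteq> 0 \<and> y \<in> UNIV"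
        then show "norm (norm (flat n y) / norm y) \<le> C * \<bar>y\<bar>"
          using C[of y] by (simp add: divide_le_eq power2_eq_square mult.assoc)
      qed simp
      show "((\<lambda>y. C * \<bar>y\<bar>) \<longlongrightarrow> 0) (at 0)" by (auto intro!: tendsto_eq_intros)
    qed
    then show ?thesis using True
      by (simp add: has_vector_derivative_def has_derivative_at flat_def)
  qed
  then show ?thesis by (simp add: derivative_sequence_def)
qed


section \<open>Termwise differentiation of series\<close>

text \<open>At each order, the Weierstrass test for the series of the next derivatives gives the
  uniform convergence that termwise differentiation requires.\<close>

lemma derivative_sequence_suminf:
  fixes F :: "nat \<Rightarrow> nat \<Rightarrow> real \<Rightarrow> 'b::banach"
  assumes "\<And>k. derivative_sequence UNIV (F k)"
    and bound: "\<And>n k x. norm (F k n x) \<le> m n k" and "\<And>n. summable (m n)"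
  shows "derivative_sequence UNIV (\<lambda>n x. \<Sum>k. F k n x)"
proof -
  have "((\<lambda>x. \<Sum>k. F k n x) has_vector_derivative (\<Sum>k. F k (Suc n) x)) (at x)" for n x
  proof -
    have sm: "summable (\<lambda>k. F k i y)" for i y
      using assms(3) bound by (rule summable_comparison_test')
    have "\<exists>g. \<forall>y\<in>UNIV. (\<lambda>k. F k n y) sums g y \<and>
        (g has_derivative (\<lambda>h. h *\<^sub>R (\<Sum>k. F k (Suc n) y))) (at y within UNIV)"
    proof (rule has_derivative_series)
      show "(F k n has_derivative (\<lambda>h. h *\<^sub>R F k (Suc n) y)) (at y within UNIV)" for k y
        using assms(1)[of k] by (simp add: derivative_sequence_def has_vector_derivative_def)
      show "(\<lambda>k. F k n 0) sums (\<Sum>k. F k n 0)" using sm by (rule summable_sums)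
      fix e :: real assume "e > 0"
      have "uniform_limit UNIV (\<lambda>N y. \<Sum>k<N. F k (Suc n) y) (\<lambda>y. \<Sum>k. F k (Suc n) y) sequentially"
        using bound assms(3) by (intro Weierstrass_m_test) auto
      then have "\<forall>\<^sub>F N in sequentially. \<forall>y\<in>UNIV.
          dist (\<Sum>k<N. F k (Suc n) y) (\<Sum>k. F k (Suc n) y) < e"
        using \<open>e > 0\<close> by (rule uniform_limitD)
      then show "\<forall>\<^sub>F N in sequentially. \<forall>y\<in>UNIV. \<forall>h.
          norm ((\<Sum>k<N. h *\<^sub>R F k (Suc n) y) - h *\<^sub>R (\<Sum>k. F k (Suc n) y)) \<le> e * norm h"
      proof (rule eventually_mono, intro ballI allI)
        fix N y h
        assume *: "\<forall>y\<in>UNIV. dist (\<Sum>k<N. F k (Suc n) y) (\<Sum>k. F k (Suc n) y) < e"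
        have "norm ((\<Sum>k<N. h *\<^sub>R F k (Suc n) y) - h *\<^sub>R (\<Sum>k. F k (Suc n) y)) =
            norm h * dist (\<Sum>k<N. F k (Suc n) y) (\<Sum>k. F k (Suc n) y)"
          by (simp add: dist_norm scaleR_sum_right[symmetric] scaleR_diff_right[symmetric])
        also have "\<dots> \<le> norm h * e"
          using * by (intro mult_left_mono) (auto simp: less_imp_le)
        finally show "norm ((\<Sum>k<N. h *\<^sub>R F k (Suc n) y) - h *\<^sub>R (\<Sum>k. F k (Suc n) y)) \<le> e * norm h"
          by (simp add: mult.commute)
      qed
    qed auto
    then obtain g where g: "\<And>y. (\<lambda>k. F k n y) sums g y"
      "\<And>y. (g has_derivative (\<lambda>h. h *\<^sub>R (\<Sum>k. F k (Suc n) y))) (at y)" by auto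
    have "g = (\<lambda>y. \<Sum>k. F k n y)" using g(1) by (auto simp: sums_iff)
    then show ?thesis using g(2)[of x] by (simp add: has_vector_derivative_def)
  qed
  then show ?thesis by (simp add: derivative_sequence_def)
qed

section \<open>Series with poles accumulating at the origin\<close>

definition pole :: "(nat \<Rightarrow> real) \<Rightarrow> nat \<Rightarrow> complex" where
  "pole lam k = Complex (1 / real (Suc k)) (1 / lam k)"

text \<open>This is the \<open>n\<close>-th derivative of the \<open>k\<close>-th summand. The
  weight makes it of size at most \<open>fact n * lam k^(n + 1 - k)\<close>: small for
  \<open>k > n\<close>, yet as large as \<open>fact k * lam k\<close> for
  \<open>n = k\<close>.\<close>

definition pole_term :: "(nat \<Rightarrow> real) \<Rightarrow> nat \<Rightarrow> nat \<Rightarrow> real \<Rightarrow> complex" where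
  "pole_term lam k n x =
     (- 1) ^ n * fact n * of_real ((1 / lam k) ^ k) / (of_real x - pole lam k) ^ Suc n"

definition pole_series :: "(nat \<Rightarrow> real) \<Rightarrow> nat \<Rightarrow> real \<Rightarrow> complex" where
  "pole_series lam n x = (\<Sum>k. pole_term lam k n x)"

context
  fixes lam :: "nat \<Rightarrow> real"
  assumes lam_ge_2: "\<And>k. lam k \<ge> 2"
begin

lemma lam_pos: "lam k > 0"
  using lam_ge_2[of k] by linarith

lemma dist_pole_ge: "1 / lam k \<le> norm (complex_of_real x - pole lam k)"
  using abs_Im_le_cmod[of "complex_of_real x - pole lam k"] lam_pos[of k] by (simp add: pole_def)

lemma norm_pole_term:
  "norm (pole_term lam k n x) =
     fact n * (1 / lam k) ^ k / norm (complex_of_real x - pole lam k) ^ Suc n"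
  using lam_pos[of k]
  by (simp add: pole_term_def norm_mult norm_divide norm_power del: power_Suc of_real_divide)

lemma norm_pole_term_le_of_dist:
  assumes "d > 0" "d \<le> norm (complex_of_real x - pole lam k)"
  shows "norm (pole_term lam k n x) \<le> fact n * (1 / lam k) ^ k * (1 / d) ^ Suc n"
proof -
  have "(1 / norm (complex_of_real x - pole lam k)) ^ Suc n \<le> (1 / d) ^ Suc n"
    using assms by (intro power_mono divide_left_mono mult_pos_pos less_le_trans[OF assms]) auto
  then have "fact n * (1 / lam k) ^ k * (1 / norm (complex_of_real x - pole lam k)) ^ Suc n
      \<le> fact n * (1 / lam k) ^ k * (1 / d) ^ Suc n"
    using lam_pos[of k] by (intro mult_left_mono) auto
  then show ?thesis unfolding norm_pole_term by (simp add: power_divide)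
qed

lemma norm_pole_term_le: "norm (pole_term lam k n x) \<le> fact n * (1 / lam k) ^ k * lam k ^ Suc n"
  using norm_pole_term_le_of_dist[of "1 / lam k" x k n] dist_pole_ge[of k x] lam_pos[of k] by simp

lemma inverse_lam_power_le: "(1 / lam k) ^ i \<le> (1 / 2) ^ i"
  using lam_ge_2[of k] lam_pos[of k] by (intro power_mono divide_left_mono) auto

lemma norm_pole_term_shift_le:
  "norm (pole_term lam (i + Suc n) n x) \<le> fact n * (1 / 2) ^ i"
proof -
  let ?l = "lam (i + Suc n)"
  have "norm (pole_term lam (i + Suc n) n x) \<le> fact n * ((1 / ?l) ^ i * ((1 / ?l) ^ Suc n * ?l ^ Suc n))"
    using norm_pole_term_le[of "i + Suc n" n x] by (simp only: power_add mult.assoc)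
  also have "(1 / ?l) ^ Suc n * ?l ^ Suc n = 1"
    using lam_pos[of "i + Suc n"] by (simp only: power_mult_distrib[symmetric]) simp
  also have "fact n * ((1 / ?l) ^ i * 1) \<le> fact n * (1 / 2) ^ i"
    using inverse_lam_power_le by simp
  finally show ?thesis .
qed

lemma summable_pole_bound: "summable (\<lambda>k. fact n * (1 / lam k) ^ k * lam k ^ Suc n)"
proof -
  \<comment> \<open>For indices \<open>i + Suc n\<close> the weight cancels
    \<open>lam^(n + 1)\<close> and leaves a geometric majorant; the finitely many dropped terms do
    not affect summability.\<close>
  have "summable (\<lambda>i. fact n * (1 / lam (i + Suc n)) ^ (i + Suc n) * lam (i + Suc n) ^ Suc n)"
  proof (rule summable_comparison_test')
    show "summable (\<lambda>i. fact n * (1 / 2 :: real) ^ i)"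
      by (intro summable_mult summable_geometric) auto
    fix i
    let ?l = "lam (i + Suc n)"
    have "(1 / ?l) ^ Suc n * ?l ^ Suc n = 1"
      using lam_pos[of "i + Suc n"] by (simp only: power_mult_distrib[symmetric]) simp
    then have "fact n * (1 / ?l) ^ (i + Suc n) * ?l ^ Suc n = fact n * (1 / ?l) ^ i"
      by (simp only: power_add mult.assoc mult_1_right)
    then show "norm (fact n * (1 / ?l) ^ (i + Suc n) * ?l ^ Suc n) \<le> fact n * (1 / 2) ^ i"
      using inverse_lam_power_le[of "i + Suc n" i] lam_pos[of "i + Suc n"] by (simp del: power_Suc)
  qed
  then show ?thesis by (subst (asm) summable_iff_shift)
qed

lemma summable_pole_term: "summable (\<lambda>k. pole_term lam k n x)"
  using summable_pole_bound norm_pole_term_le by (rule summable_comparison_test')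

text \<open>The bounds on the terms are uniform in \<open>x\<close>, so the sum is smooth even at 0,
  where the poles accumulate.\<close>

lemma derivative_sequence_pole_series: "derivative_sequence UNIV (pole_series lam)"
proof -
  have "derivative_sequence UNIV (pole_term lam k)" for k
    unfolding derivative_sequence_def
  proof (intro allI ballI)
    fix n and x :: real
    have nz: "complex_of_real x - pole lam k \<noteq> 0"
      using dist_pole_ge[of k x] lam_pos[of k] by (auto simp: field_simps)
    define c where "c = (- 1) ^ n * fact n * complex_of_real ((1 / lam k) ^ k)"
    define w where "w = complex_of_real x - pole lam k"
    have "w \<noteq> 0" using nz by (simp add: w_def)
    have "((\<lambda>z. z - pole lam k) has_field_derivative 1) (at (complex_of_real x))"
      by (auto intro!: derivative_eq_intros)
    from DERIV_cmult[OF DERIV_inverse_fun[OF DERIV_power_Suc[OF this, of n]], of c]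
    have "((\<lambda>z. c / (z - pole lam k) ^ Suc n) has_field_derivative
        - c * ((1 + of_nat n) * (w ^ n * inverse ((w ^ Suc n) ^ 2)))) (at (complex_of_real x))"
      using nz by (simp add: w_def divide_inverse numeral_2_eq_2 mult_ac del: power_Suc)
    also have "w ^ n * inverse ((w ^ Suc n) ^ 2) = inverse (w ^ Suc (Suc n))"
      using \<open>w \<noteq> 0\<close> by (simp add: field_simps power2_eq_square)
    also have "- c * ((1 + of_nat n) * inverse (w ^ Suc (Suc n))) = pole_term lam k (Suc n) x"
      by (simp add: c_def w_def pole_term_def divide_inverse algebra_simps)
    finally have "((\<lambda>z. c / (z - pole lam k) ^ Suc n) has_field_derivative
        pole_term lam k (Suc n) x) (at (complex_of_real x))" .
    then show "(pole_term lam k n has_vector_derivative pole_term lam k (Suc n) x) (at x)"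
      unfolding pole_term_def[of lam k n] c_def by (rule has_vector_derivative_real_field)
  qed
  then show ?thesis
    unfolding pole_series_def using norm_pole_term_le summable_pole_bound
    by (rule derivative_sequence_suminf)
qed

text \<open>A neighbourhood of \<open>x0\<close> keeps a positive distance \<open>d\<close> from all
  poles, and the weights are dominated by a geometric series.\<close>

lemma pole_series_analytic_bound:
  assumes "\<And>k. lam k \<ge> real (Suc k)" "x0 \<noteq> 0"
  shows "\<exists>C>0. \<exists>D>0. \<forall>n. \<forall>x\<in>ball x0 (\<bar>x0\<bar> / 2). norm (pole_series lam n x) \<le> C * D ^ n * fact n"
proof -
  \<comment> \<open>From index \<open>N\<close> on, the poles have modulus at most
    \<open>\<bar>x0\<bar> / 4\<close>, since both coordinates are at most
    \<open>1 / (k + 1)\<close>.\<close>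
  obtain N where N: "8 / \<bar>x0\<bar> < real N" using reals_Archimedean2 by blast
  \<comment> \<open>The sum stands in for the maximum of the finitely many \<open>lam j\<close>; it
    handles the poles below \<open>N\<close> through their height over the real axis.\<close>
  define d where "d = min (\<bar>x0\<bar> / 4) (1 / (1 + (\<Sum>j<N. lam j)))"
  have S: "0 \<le> (\<Sum>j<N. lam j)" using lam_pos by (auto intro: sum_nonneg less_imp_le)
  then have d: "d > 0" using assms(2) by (auto simp: d_def)
  have dist: "d \<le> norm (complex_of_real x - pole lam k)" if x: "x \<in> ball x0 (\<bar>x0\<bar> / 2)" for x k
  proof (cases "k < N")
    case True
    have "lam k \<le> (\<Sum>j<N. lam j)"
      using True lam_pos by (intro member_le_sum) (auto intro: less_imp_le)
    then have "1 / (1 + (\<Sum>j<N. lam j)) \<le> 1 / lam k"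
      using S lam_pos[of k] by (intro divide_left_mono) auto
    then show ?thesis using dist_pole_ge[of k x] by (auto simp: d_def)
  next
    case False
    have "8 / \<bar>x0\<bar> \<le> real (Suc k)" using N False by linarith
    then have k: "1 / real (Suc k) \<le> \<bar>x0\<bar> / 8" using assms(2) by (simp add: field_simps)
    have "1 / lam k \<le> 1 / real (Suc k)"
      using assms(1)[of k] lam_pos[of k] by (intro divide_left_mono) auto
    then have "norm (pole lam k) \<le> \<bar>x0\<bar> / 4"
      using cmod_le[of "pole lam k"] k lam_pos[of k] by (simp add: pole_def)
    moreover have "\<bar>x0\<bar> / 2 \<le> \<bar>x\<bar>" using x unfolding mem_ball dist_real_def by linarith
    ultimately show ?thesis
      using norm_triangle_ineq2[of "complex_of_real x" "pole lam k"] by (simp add: d_def)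
  qed
  have geo: "(\<lambda>i. (1 / 2 :: real) ^ i) sums 2" using geometric_sums[of "1 / 2 :: real"] by simp
  have "norm (pole_series lam n x) \<le> (2 / d) * (1 / d) ^ n * fact n" if "x \<in> ball x0 (\<bar>x0\<bar> / 2)" for n x
  proof -
    have "norm (pole_term lam k n x) \<le> fact n * (1 / d) ^ Suc n * (1 / 2) ^ k" for k
    proof -
      have "norm (pole_term lam k n x) \<le> (fact n * (1 / d) ^ Suc n) * (1 / lam k) ^ k"
        using norm_pole_term_le_of_dist[OF d dist[OF that], of k n] by (simp only: mult_ac)
      also have "\<dots> \<le> fact n * (1 / d) ^ Suc n * (1 / 2) ^ k"
        using d inverse_lam_power_le by (intro mult_left_mono) auto
      finally show ?thesis .
    qed
    then have "norm (pole_series lam n x) \<le> (\<Sum>k. fact n * (1 / d) ^ Suc n * (1 / 2) ^ k)"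
      unfolding pole_series_def using geo
      by (intro norm_suminf_le) (auto intro!: summable_mult simp del: power_Suc simp: sums_iff)
    also have "\<dots> = fact n * (1 / d) ^ Suc n * 2"
      using sums_mult[OF geo] by (rule sums_unique[symmetric])
    finally show ?thesis by (simp add: mult_ac)
  qed
  then show ?thesis using d by (intro exI[of _ "2 / d"] exI[of _ "1 / d"] conjI allI ballI) auto
qed

text \<open>The \<open>k\<close>-th term dominates at the point \<open>1 / (k + 1)\<close>: the earlier terms are beaten by the
  growth condition on \<open>lam k\<close>, the later ones contribute at most \<open>2 * fact k\<close>.\<close>

lemma pole_series_lower_bound:
  assumes "lam k \<ge> (\<Sum>j<k. lam j ^ Suc k) + 3 + L"
  shows "norm (pole_series lam k (1 / real (Suc k))) > L"
proof -
  let ?x = "1 / real (Suc k)"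
  let ?T = "\<lambda>j. pole_term lam j k ?x"
  have geo: "(\<lambda>i. (1 / 2 :: real) ^ i) sums 2" using geometric_sums[of "1 / 2 :: real"] by simp
  have "pole_series lam k ?x = (\<Sum>j. ?T (j + Suc k)) + (\<Sum>j<Suc k. ?T j)"
    unfolding pole_series_def using summable_pole_term by (rule suminf_split_initial_segment)
  then have split: "pole_series lam k ?x = (\<Sum>j. ?T (j + Suc k)) + (\<Sum>j<k. ?T j) + ?T k" by simp
  have "norm (\<Sum>j. ?T (j + Suc k)) \<le> (\<Sum>j. fact k * (1 / 2) ^ j)"
    using geo norm_pole_term_shift_le
    by (intro norm_suminf_le) (auto intro!: summable_mult simp: sums_iff)
  also have "\<dots> = fact k * 2" using sums_mult[OF geo] by (rule sums_unique[symmetric])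
  finally have tail: "norm (\<Sum>j. ?T (j + Suc k)) \<le> fact k * 2" .
  have "norm (\<Sum>j<k. ?T j) \<le> (\<Sum>j<k. fact k * lam j ^ Suc k)"
  proof (rule sum_norm_le)
    fix j
    have "(1 / lam j) ^ j \<le> 1" using lam_ge_2[of j] by (intro power_le_one) auto
    then have "fact k * (1 / lam j) ^ j * lam j ^ Suc k \<le> fact k * 1 * lam j ^ Suc k"
      using lam_pos[of j] by (intro mult_right_mono mult_left_mono) auto
    then have "fact k * (1 / lam j) ^ j * lam j ^ Suc k \<le> fact k * lam j ^ Suc k"
      by (simp only: mult_1_right)
    then show "norm (?T j) \<le> fact k * lam j ^ Suc k" by (rule order.trans[OF norm_pole_term_le])
  qed
  then have head: "norm (\<Sum>j<k. ?T j) \<le> fact k * (\<Sum>j<k. lam j ^ Suc k)"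
    by (simp only: sum_distrib_left)
  \<comment> \<open>The pole lies exactly above \<open>?x\<close>, so the general lower bound for
    the distance is attained.\<close>
  have "complex_of_real ?x - pole lam k = - (of_real (1 / lam k) * \<i>)"
    by (simp add: pole_def complex_eq_iff)
  then have dk: "norm (complex_of_real ?x - pole lam k) = 1 / lam k"
    using lam_pos[of k] by (simp add: norm_divide)
  then have main: "norm (?T k) = fact k * lam k"
    unfolding norm_pole_term dk using lam_pos[of k] by (simp add: field_simps)
  \<comment> \<open>Of the 3 in the growth condition, 2 absorbs the tail and 1 makes the final
    inequality strict.\<close>
  have "fact k * (1 + L) \<le> fact k * (lam k - (\<Sum>j<k. lam j ^ Suc k) - 2)"
    using assms by (intro mult_left_mono) auto
  also have "\<dots> \<le> norm (pole_series lam k ?x)"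
  proof -
    have "norm (?T k) \<le> norm (pole_series lam k ?x) + norm (\<Sum>j. ?T (j + Suc k)) + norm (\<Sum>j<k. ?T j)"
      unfolding split by norm
    then show ?thesis using tail head main by (simp add: algebra_simps)
  qed
  finally have *: "fact k * (1 + L) \<le> norm (pole_series lam k ?x)" .
  show ?thesis
  proof (cases "L \<ge> 0")
    case True
    have "1 * (1 + L) \<le> fact k * (1 + L)" using True by (intro mult_right_mono) auto
    also note *
    finally show ?thesis by simp
  qed (use norm_ge_zero[of "pole_series lam k ?x"] in linarith)
qed

end

section \<open>Choice of the parameters\<close>

text \<open>The condition involves all earlier values, but for an increasing sequence the sum is at
  most the number of terms times the last one. Recursion on the previous value alone therefore
  suffices.\<close>

lemma fast_growing_sequence_exists:
  fixes L :: "nat \<Rightarrow> real"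
  assumes "\<And>k. L k \<ge> 0"
  shows "\<exists>lam :: nat \<Rightarrow> real. \<forall>k. lam k \<ge> 2 \<and> lam k \<ge> real (Suc k) \<and>
           lam k \<ge> (\<Sum>j<k. lam j ^ Suc k) + 3 + L k"
proof -
  define lam where
    "lam = rec_nat (3 + L 0) (\<lambda>k r. r + (real (Suc k) * r ^ Suc (Suc k) + 3 + L (Suc k)))"
  have lam0: "lam 0 = 3 + L 0"
    and lamS: "lam (Suc k) = lam k + (real (Suc k) * lam k ^ Suc (Suc k) + 3 + L (Suc k))" for k
    by (simp_all add: lam_def)
  have ge: "lam k \<ge> 3 + real k" for k
  proof (induction k)
    case 0
    then show ?case using assms by (simp add: lam0)
  next
    case (Suc k)
    have "0 \<le> real (Suc k) * lam k ^ Suc (Suc k)" using Suc by auto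
    then show ?case unfolding lamS using Suc assms[of "Suc k"] by linarith
  qed
  have "lam k \<le> lam (Suc k)" for k
  proof -
    have "0 \<le> real (Suc k) * lam k ^ Suc (Suc k)" using ge[of k] by auto
    then show ?thesis unfolding lamS using assms[of "Suc k"] by linarith
  qed
  then have mono: "mono lam" by (simp add: mono_iff_le_Suc)
  have "lam k \<ge> (\<Sum>j<k. lam j ^ Suc k) + 3 + L k" for k
  proof (cases k)
    case 0
    then show ?thesis by (simp add: lam0)
  next
    case (Suc m)
    have "(\<Sum>j<k. lam j ^ Suc k) \<le> (\<Sum>j<k. lam m ^ Suc k)"
    proof (intro sum_mono power_mono)
      fix j assume "j \<in> {..<k}"
      then show "lam j \<le> lam m" using mono Suc by (auto simp: mono_def)
      show "0 \<le> lam j" using ge[of j] by linarith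
    qed
    also have "\<dots> = real (Suc m) * lam m ^ Suc (Suc m)" using Suc by simp
    finally show ?thesis using lamS[of m] ge[of m] Suc by simp
  qed
  moreover have "lam k \<ge> 2" "lam k \<ge> real (Suc k)" for k using ge[of k] by simp_all
  ultimately show ?thesis by blast
qed


section \<open>The counterexample\<close>

text \<open>Everything is phrased as bounds on an explicit family, because bounds, unlike failure of
  membership, can be compared with those of the real and imaginary parts.\<close>

lemma exists_flat_complex_function:
  assumes "weight_sequence M"
  shows "\<exists>F :: nat \<Rightarrow> real \<Rightarrow> complex. derivative_sequence UNIV F \<and> (\<forall>n. F n 0 = 0) \<and>
     (\<forall>x\<in>- {0}. \<exists>r>0. \<exists>C>0. \<exists>D>0. \<forall>n. \<forall>y\<in>ball x r. norm (F n y) \<le> C * D ^ n * fact n) \<and>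
     (\<forall>V A B. open V \<longrightarrow> 0 \<in> V \<longrightarrow> (\<exists>n. \<exists>y\<in>V. norm (F n y) > A * B ^ n * fact n * M n))"
proof -
  have M: "M 0 = 1" "\<And>n. M n > 0" "mono M" using assms by (auto simp: weight_sequence_def)
  \<comment> \<open>These are the derivatives of the reciprocal of the flat factor. They do not
    involve \<open>lam\<close>, so \<open>L\<close> can be fixed before \<open>lam\<close> is
    chosen.\<close>
  define K where "K n x = (deriv ^^ n) (\<lambda>z. exp (1 / z\<^sup>2)) (complex_of_real x)" for n x
  have K: "derivative_sequence (- {0}) K"
    unfolding K_def by (rule derivative_sequence_holomorphic[of "- {0}"]) (auto intro!: holomorphic_intros)
  define S where "S k = (\<Sum>j\<le>k. real (k choose j) * norm (K (k - j) (1 / real (Suc k))))" for k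
  \<comment> \<open>This is what Leibniz' rule yields for the \<open>k\<close>-th derivative of the
    pole series at \<open>1 / (k + 1)\<close> when both constants of the class are replaced by
    \<open>k\<close>.\<close>
  define L where "L k = real k * real k ^ k * fact k * M k * S k" for k
  have S: "S k \<ge> 0" for k by (simp add: S_def sum_nonneg)
  have "L k \<ge> 0" for k using S M(2)[of k] by (simp add: L_def)
  then obtain lam where lam: "\<And>k. lam k \<ge> 2" "\<And>k. lam k \<ge> real (Suc k)"
    "\<And>k. lam k \<ge> (\<Sum>j<k. lam j ^ Suc k) + 3 + L k"
    using fast_growing_sequence_exists by metis
  let ?g = "pole_series lam"
  have g: "derivative_sequence UNIV ?g" using lam(1) by (rule derivative_sequence_pole_series)
  define F where "F n x = (\<Sum>j\<le>n. of_nat (n choose j) * (flat j x * ?g (n - j) x))" for n x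
  have F: "derivative_sequence UNIV F"
    using derivative_sequence_mult[OF derivative_sequence_flat g] unfolding F_def .
  have F0: "F n 0 = 0" for n by (simp add: F_def flat_def)
  have ana: "\<exists>r>0. \<exists>C>0. \<exists>D>0. \<forall>n. \<forall>y\<in>ball x r. norm (F n y) \<le> C * D ^ n * fact n"
    if x: "x \<noteq> 0" for x
  proof -
    obtain C D where CD: "C > 0" "D > 0"
      "\<And>n y. y \<in> ball x (\<bar>x\<bar> / 2) \<Longrightarrow> norm (?g n y) \<le> C * D ^ n * fact n"
      using pole_series_analytic_bound[OF lam(1,2) x] by blast
    have fl: "norm (flat n y) \<le> 1 * (8 / \<bar>x\<bar>) ^ n * fact n" if y: "y \<in> ball x (\<bar>x\<bar> / 2)" for n y
    proof -
      have y': "\<bar>x\<bar> / 2 \<le> \<bar>y\<bar>" using y unfolding mem_ball dist_real_def by linarith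
      then have "y \<noteq> 0" using x by auto
      then have "norm (flat n y) \<le> exp (- 1 / (6 * y\<^sup>2)) * (4 / \<bar>y\<bar>) ^ n * fact n"
        by (rule norm_flat_le)
      also have "\<dots> \<le> 1 * (8 / \<bar>x\<bar>) ^ n * fact n"
        using y' x \<open>y \<noteq> 0\<close> by (intro mult_mono power_mono) (auto simp: field_simps)
      finally show ?thesis .
    qed
    have "norm (F n y) \<le> 1 * C * (8 / \<bar>x\<bar> + D) ^ n * fact n" if "y \<in> ball x (\<bar>x\<bar> / 2)" for n y
      unfolding F_def using fl[OF that] CD(3)[OF that] by (rule norm_leibniz_le) (use CD in auto)
    then show ?thesis using CD x
      by (intro exI[of _ "\<bar>x\<bar> / 2"] exI[of _ "1 * C"] exI[of _ "8 / \<bar>x\<bar> + D"] conjI) (auto intro: add_pos_pos)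
  qed
  have big: "\<exists>n. \<exists>y\<in>V. norm (F n y) > A * B ^ n * fact n * M n" if V: "open V" "0 \<in> V" for V A B
  proof (rule ccontr)
    assume "\<not> ?thesis"
    then have le: "norm (F n y) \<le> A * B ^ n * fact n * M n" if "y \<in> V" for n y
      using that by (meson not_le)
    obtain r where r: "r > 0" "ball 0 r \<subseteq> V" using V open_contains_ball by blast
    \<comment> \<open>A large \<open>k\<close> puts \<open>1 / (k + 1)\<close> into \<open>V\<close>
      and dominates both constants; being above 1, it also has increasing powers.\<close>
    obtain k where k: "max (max \<bar>A\<bar> \<bar>B\<bar>) (max 1 (1 / r)) < real k" using reals_Archimedean2 by blast
    define y where "y = 1 / real (Suc k)"
    have y0: "y \<noteq> 0" by (simp add: y_def)
    have "1 / r < real (Suc k)" using k by simp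
    then have "y < r" using r(1) by (simp add: y_def field_simps)
    then have yV: "y \<in> V" using r(2) by (auto simp: y_def)
    have Fj: "norm (F j y) \<le> real k * real k ^ k * fact k * M k" if "j \<le> k" for j
    proof -
      have "norm (F j y) \<le> A * B ^ j * fact j * M j" using le[OF yV] .
      also have "\<dots> \<le> \<bar>A * B ^ j * fact j * M j\<bar>" by simp
      also have "\<dots> = \<bar>A\<bar> * \<bar>B\<bar> ^ j * fact j * M j"
        using M(2)[of j] by (simp add: abs_mult power_abs)
      also have "\<dots> \<le> real k * real k ^ k * fact k * M k"
      proof (intro mult_mono)
        have "\<bar>B\<bar> ^ j \<le> real k ^ j" using k by (intro power_mono) auto
        also have "\<dots> \<le> real k ^ k" using k that by (intro power_increasing) auto
        finally show "\<bar>B\<bar> ^ j \<le> real k ^ k" .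
        show "fact j \<le> (fact k :: real)" using that by (rule fact_mono)
        show "M j \<le> M k" using M(3) that by (simp add: mono_def)
      qed (use k M(2)[of j] in auto)
      finally show ?thesis .
    qed
    define P where "P n x = (\<Sum>j\<le>n. of_nat (n choose j) * (F j x * K (n - j) x))" for n x
    have P: "derivative_sequence (- {0}) P"
      unfolding P_def using F K by (intro derivative_sequence_mult) (auto simp: derivative_sequence_def)
    \<comment> \<open>Off 0 the two exponentials cancel, so \<open>P\<close> and the pole series are
      families for the same function and agree at order \<open>k\<close>.\<close>
    have "?g 0 x = P 0 x" if "x \<in> - {0}" for x
      using that by (simp add: P_def F_def K_def flat_0 exp_minus)
    then have "nth_derivative k (?g 0) y = P k y"
      using y0 by (intro nth_derivative_eq[OF _ P]) auto
    moreover have "nth_derivative k (?g 0) y = ?g k y"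
      by (rule nth_derivative_eq[OF _ g]) auto
    ultimately have "norm (?g k y) = norm (P k y)" by simp
    also have "\<dots> \<le> (\<Sum>j\<le>k. real k * real k ^ k * fact k * M k * (real (k choose j) * norm (K (k - j) y)))"
      unfolding P_def
    proof (rule sum_norm_le)
      fix j assume "j \<in> {..k}"
      then have "norm (F j y) * (real (k choose j) * norm (K (k - j) y)) \<le>
          real k * real k ^ k * fact k * M k * (real (k choose j) * norm (K (k - j) y))"
        using Fj by (intro mult_right_mono) auto
      then show "norm (of_nat (k choose j) * (F j y * K (k - j) y)) \<le>
          real k * real k ^ k * fact k * M k * (real (k choose j) * norm (K (k - j) y))"
        by (simp only: norm_mult norm_of_nat mult_ac)
    qed
    also have "\<dots> = L k" by (simp only: L_def S_def y_def sum_distrib_left)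
    also have "\<dots> < norm (?g k y)"
      unfolding y_def using lam(1,3) by (rule pole_series_lower_bound)
    finally show False by simp
  qed
  show ?thesis by (intro exI[of _ F] conjI allI impI ballI) (assumption | rule F F0 ana big | simp)+
qed

section \<open>From derivative bounds to membership in the classes\<close>

lemma denjoy_carlemanE:
  assumes "f \<in> denjoy_carleman M U" "x \<in> U"
  obtains V A B where "open V" "x \<in> V" "A > 0" "B > 0"
    "\<And>n y. y \<in> V \<Longrightarrow> norm (nth_derivative n f y) \<le> A * B ^ n * fact n * M n"
proof -
  from assms obtain V where "open V" "x \<in> V"
    "\<exists>A>0. \<exists>B>0. \<forall>n. \<forall>y\<in>V. norm (nth_derivative n f y) \<le> A * B ^ n * fact n * M n"
    unfolding denjoy_carleman_def by blast
  then show thesis using that by blast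
qed

text \<open>A contraction preserves the bounds, and \<open>M n \<ge> 1\<close> turns analytic bounds
  into bounds of the class. With \<open>T\<close> the identity, \<open>Re\<close> or
  \<open>Im\<close>, this serves both scalar fields.\<close>

lemma bounded_linear_image_classes:
  fixes F :: "nat \<Rightarrow> real \<Rightarrow> 'b::real_normed_vector" and T :: "'b \<Rightarrow> 'c::real_normed_vector"
  assumes M: "\<And>n. M n \<ge> 1"
    and T: "bounded_linear T" "\<And>z. norm (T z) \<le> norm z"
    and F: "derivative_sequence UNIV F" "\<And>n. F n 0 = 0"
    and ana: "\<forall>x\<in>- {0}.
      \<exists>r>0. \<exists>C>0. \<exists>D>0. \<forall>n. \<forall>y\<in>ball x r. norm (F n y) \<le> C * D ^ n * fact n"
  shows "(\<lambda>x. T (F 0 x)) \<in> smooth_functions UNIV"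
    and "(\<lambda>x. T (F 0 x)) \<in> denjoy_carleman M (UNIV - {0})"
    and "(\<lambda>x. T (F 0 x)) \<in> formally_denjoy_carleman M UNIV 0"
    and "nth_derivative n (\<lambda>x. T (F 0 x)) y = T (F n y)"
proof -
  note ds = derivative_sequence_bounded_linear[OF T(1) F(1)]
  have nd: "nth_derivative n (\<lambda>x. T (F 0 x)) y = T (F n y)" for n y
    by (rule nth_derivative_eq[OF _ ds]) auto
  have sm: "(\<lambda>x. T (F 0 x)) \<in> smooth_functions UNIV"
    by (rule smooth_functions_derivative_sequence[OF _ ds]) auto
  show "nth_derivative n (\<lambda>x. T (F 0 x)) y = T (F n y)" "(\<lambda>x. T (F 0 x)) \<in> smooth_functions UNIV"
    by fact+
  have M0: "M n \<ge> 0" for n using M[of n] by linarith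
  \<comment> \<open>All derivatives vanish at 0, so both constants can be 1.\<close>
  then show "(\<lambda>x. T (F 0 x)) \<in> formally_denjoy_carleman M UNIV 0"
    using sm by (auto simp: formally_denjoy_carleman_def nd F(2) linear_0[OF bounded_linear.linear[OF T(1)]]
        intro!: exI[of _ 1])
  have "\<exists>V. open V \<and> V \<subseteq> UNIV - {0} \<and> x \<in> V \<and>
      (\<exists>A>0. \<exists>B>0. \<forall>n. \<forall>y\<in>V. norm (T (F n y)) \<le> A * B ^ n * fact n * M n)" if x: "x \<noteq> 0" for x
  proof -
    obtain r C D where *: "r > 0" "C > 0" "D > 0"
      "\<And>n y. y \<in> ball x r \<Longrightarrow> norm (F n y) \<le> C * D ^ n * fact n"
      using bspec[OF ana, of x] x by blast
    have "norm (T (F n y)) \<le> C * D ^ n * fact n * M n" if "y \<in> ball x r" for n y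
    proof -
      have "norm (T (F n y)) \<le> C * D ^ n * fact n * 1" using order.trans[OF T(2) *(4)[OF that]] by simp
      also have "\<dots> \<le> C * D ^ n * fact n * M n" using *(2,3) M by (intro mult_left_mono) auto
      finally show ?thesis .
    qed
    \<comment> \<open>The radius \<open>r\<close> is arbitrary, so 0 has to be removed from the
      ball.\<close>
    then show ?thesis
      using *(1-3) x by (intro exI[of _ "ball x r - {0}"] conjI exI[of _ C] exI[of _ D]) auto
  qed
  then show "(\<lambda>x. T (F 0 x)) \<in> denjoy_carleman M (UNIV - {0})"
    using sm by (auto simp: denjoy_carleman_def nd smooth_functions_def)
qed

theorem theorem1p2:
  fixes M :: "nat \<Rightarrow> real"
  assumes "weight_sequence M"
  shows "(\<exists>f :: real \<Rightarrow> real. f \<in> smooth_functions UNIV \<and>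
            f \<in> denjoy_carleman M (UNIV - {0}) \<and>
            f \<in> formally_denjoy_carleman M UNIV 0 \<and>
            f \<notin> denjoy_carleman M UNIV) \<and>
         (\<exists>f :: real \<Rightarrow> complex. f \<in> smooth_functions UNIV \<and>
            f \<in> denjoy_carleman M (UNIV - {0}) \<and>
            f \<in> formally_denjoy_carleman M UNIV 0 \<and>
            f \<notin> denjoy_carleman M UNIV)"
proof -
  have "M 0 = 1" "mono M" using assms by (auto simp: weight_sequence_def)
  then have M: "M n \<ge> 1" for n by (metis monoD le0)
  obtain F :: "nat \<Rightarrow> real \<Rightarrow> complex" where F: "derivative_sequence UNIV F" "\<forall>n. F n 0 = 0"
    and ana: "\<forall>x\<in>- {0}.
      \<exists>r>0. \<exists>C>0. \<exists>D>0. \<forall>n. \<forall>y\<in>ball x r. norm (F n y) \<le> C * D ^ n * fact n"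
    and big: "\<forall>V A B. open V \<longrightarrow> 0 \<in> V \<longrightarrow> (\<exists>n. \<exists>y\<in>V. norm (F n y) > A * B ^ n * fact n * M n)"
    using exists_flat_complex_function[OF assms] by (elim exE conjE) (rule that)
  note cl = bounded_linear_image_classes[where M = M, OF M _ _ F(1) F(2)[rule_format] ana]
  note cl_id = cl[OF bounded_linear_ident order.refl]
  note cl_Re = cl[OF bounded_linear_Re, unfolded real_norm_def, OF abs_Re_le_cmod]
  note cl_Im = cl[OF bounded_linear_Im, unfolded real_norm_def, OF abs_Im_le_cmod]
  have "F 0 \<notin> denjoy_carleman M UNIV"
  proof
    assume "F 0 \<in> denjoy_carleman M UNIV"
    then obtain V A B where V: "open V" "0 \<in> V"
      "\<And>n y. y \<in> V \<Longrightarrow> norm (nth_derivative n (F 0) y) \<le> A * B ^ n * fact n * M n"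
      by (rule denjoy_carlemanE[of _ _ _ 0]) auto
    obtain n y where "y \<in> V" "norm (F n y) > A * B ^ n * fact n * M n"
      using big V(1,2) by blast
    then show False using V(3)[of y n] by (simp add: cl_id(4))
  qed
  \<comment> \<open>The argument does not decide which part fails: were both in the class, the
    constants \<open>A + C\<close> and \<open>max B D\<close> would bound \<open>F\<close> near
    0.\<close>
  moreover have "(\<lambda>x. Re (F 0 x)) \<notin> denjoy_carleman M UNIV \<or> (\<lambda>x. Im (F 0 x)) \<notin> denjoy_carleman M UNIV"
  proof (rule ccontr)
    assume "\<not> ?thesis"
    then have re: "(\<lambda>x. Re (F 0 x)) \<in> denjoy_carleman M UNIV"
      and im: "(\<lambda>x. Im (F 0 x)) \<in> denjoy_carleman M UNIV" by auto
    obtain V A B where V: "open V" "0 \<in> V" "A > 0" "B > 0"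
      "\<And>n y. y \<in> V \<Longrightarrow> norm (nth_derivative n (\<lambda>x. Re (F 0 x)) y) \<le> A * B ^ n * fact n * M n"
      using re by (rule denjoy_carlemanE[of _ _ _ 0]) auto
    obtain W C D where W: "open W" "0 \<in> W" "C > 0" "D > 0"
      "\<And>n y. y \<in> W \<Longrightarrow> norm (nth_derivative n (\<lambda>x. Im (F 0 x)) y) \<le> C * D ^ n * fact n * M n"
      using im by (rule denjoy_carlemanE[of _ _ _ 0]) auto
    have "norm (F n y) \<le> (A + C) * (max B D) ^ n * fact n * M n" if "y \<in> V \<inter> W" for n y
    proof -
      have "norm (F n y) \<le> \<bar>Re (F n y)\<bar> + \<bar>Im (F n y)\<bar>" by (rule cmod_le)
      also have "\<dots> \<le> A * B ^ n * fact n * M n + C * D ^ n * fact n * M n"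
        using V(5)[of y n] W(5)[of y n] that by (simp add: cl_Re(4) cl_Im(4))
      also have "\<dots> \<le> A * (max B D) ^ n * fact n * M n + C * (max B D) ^ n * fact n * M n"
        using V(3,4) W(3,4) M[of n]
        by (intro add_mono mult_right_mono mult_left_mono power_mono) auto
      finally show ?thesis by (simp add: algebra_simps)
    qed
    moreover obtain n y where "y \<in> V \<inter> W" "norm (F n y) > (A + C) * (max B D) ^ n * fact n * M n"
      using big V(1,2) W(1,2) by (meson open_Int IntI)
    ultimately show False by (meson not_le)
  qed
  ultimately show ?thesis using cl_id(1-3) cl_Re(1-3) cl_Im(1-3) by blast
qed

end
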